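(* Suppose $G$ is a discrete group, $\mu\in M(G)$ vanishes on finite sets (that is, $\mu(\mathbb 1_F)=0$ for each finite $F\subset G$), and $x\in G\setminus\{e\}$. Then there exists a net $\{S_\alpha\}$ in $\mathscr C^+$ such that $\mu_{S_\alpha}\to\mu$ but $S_\alpha\cap xS_\alpha=\varnothing$ for all $\alpha$.
   Context: $M(G)$ is the set of means on $L_\infty(G)=\ell_\infty(G)$: linear functionals $\mu$ with $\|\mu\|=1$ and $\mu\ge0$, endowed with the $w^*$-topology (convergence is in this topology). $\mathscr C^+$ is the set of compact subsets of $G$ with positive Haar (counting) measure, i.e. the nonempty finite subsets of $G$. For $A\in\mathscr C^+$, $\mu_A=\mathbb 1_A/|A|$, regarded as the mean $\phi\mapsto\frac1{|A|}\sum_{y\in A}\phi(y)$. *)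

theory Defs
  imports "HOL-Analysis.Analysis"
begin

text \<open>
  A discrete group is a type of class \<open>group_add\<close> (written additively, but not assumed
  commutative) carrying the discrete topology. On such a type every function is continuous, so
  the bounded continuous functions with the supremum norm are exactly the space of
  bounded complex functions.
\<close>

type_synonym 'a linfty = "'a \<Rightarrow>\<^sub>C complex"

text \<open>
  The norm of \<open>\<Rightarrow>\<^sub>L\<close> is the operator norm. Elements of \<open>\<Rightarrow>\<^sub>L\<close> are only real-linear;
  the set \<open>means\<close> below requires complex homogeneity in addition.
\<close>

type_synonym 'a functional = "'a linfty \<Rightarrow>\<^sub>L complex"

definition linfty_indicator :: "'a::discrete_topology set \<Rightarrow> 'a linfty"
  where "linfty_indicator A = Bcontfun (indicator A)"

definition means :: "'a::discrete_topology functional set"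
  where "means = {\<mu>.
    (\<forall>c \<phi> \<psi>. (\<forall>y. apply_bcontfun \<psi> y = c * apply_bcontfun \<phi> y)
        \<longrightarrow> blinfun_apply \<mu> \<psi> = c * blinfun_apply \<mu> \<phi>) \<and>
    norm \<mu> = 1 \<and>
    (\<forall>\<phi>. (\<forall>y. apply_bcontfun \<phi> y \<in> \<real>\<^sub>\<ge>\<^sub>0) \<longrightarrow> blinfun_apply \<mu> \<phi> \<in> \<real>\<^sub>\<ge>\<^sub>0)}"

text \<open>
  For scalar-valued functionals the strong operator topology is the topology of pointwise
  convergence, that is, the weak-* topology.
\<close>

definition means_topology :: "'a::discrete_topology functional topology"
  where "means_topology = subtopology strong_operator_topology means"

definition positive_compacts :: "'a::discrete_topology set set"
  where "positive_compacts = {A. compact A \<and> 0 < emeasure (count_space UNIV) A}"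

definition uniform_mean :: "'a::discrete_topology set \<Rightarrow> 'a functional"
  where "uniform_mean A = Blinfun (\<lambda>\<phi>. (\<Sum>y\<in>A. apply_bcontfun \<phi> y) / of_nat (card A))"

definition directed_by :: "'i set \<Rightarrow> ('i \<Rightarrow> 'i \<Rightarrow> bool) \<Rightarrow> bool"
  where "directed_by I le \<longleftrightarrow> I \<noteq> {} \<and> reflp_on I le \<and> transp_on I le \<and>
    (\<forall>a\<in>I. \<forall>b\<in>I. \<exists>c\<in>I. le a c \<and> le b c)"

definition tails :: "'i set \<Rightarrow> ('i \<Rightarrow> 'i \<Rightarrow> bool) \<Rightarrow> 'i filter"
  where "tails I le = (INF a\<in>I. principal {b \<in> I. le a b})"

text \<open>
  Since \<open>Bcontfun\<close> and \<open>Blinfun\<close> are meaningful only on bounded continuous functions and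
  bounded linear maps, and an infimum of filters may degenerate, the following facts confirm
  that the above definitions have the intended values.
\<close>

lemma apply_linfty_indicator: "apply_bcontfun (linfty_indicator A) = indicator A"
proof -
  have "continuous_on UNIV (indicator A :: 'a \<Rightarrow> complex)"
    by (auto simp: continuous_on_open_vimage open_discrete)
  moreover have "bounded (range (indicator A :: 'a \<Rightarrow> complex))"
    by (rule boundedI[where B = 1]) (auto simp: indicator_def)
  ultimately show ?thesis
    unfolding linfty_indicator_def by (intro Bcontfun_inverse) (auto simp: bcontfun_def)
qed

lemma positive_compacts_eq: "positive_compacts = {A. finite A \<and> A \<noteq> {}}"
proof -
  have fin: "compact A \<longleftrightarrow> finite A" for A :: "'a set"
  proof
    assume cpt: "compact A"
    obtain D where D: "D \<subseteq> range (\<lambda>y :: 'a. {y})" "finite D" "A \<subseteq> \<Union>D"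
    proof (rule compactE[OF cpt])
      show "A \<subseteq> \<Union>(range (\<lambda>y. {y}))" by auto
      show "open B" for B :: "'a set" by (rule open_discrete)
    qed
    have "finite (\<Union>D)"
    proof (rule finite_Union[OF D(2)])
      fix M assume "M \<in> D"
      then show "finite M" using D(1) by auto
    qed
    then show "finite A" using D(3) by (rule rev_finite_subset)
  qed (rule finite_imp_compact)
  have pos: "0 < emeasure (count_space UNIV) A \<longleftrightarrow> A \<noteq> {}" if "finite A" for A :: "'a set"
    using that by (simp add: emeasure_count_space zero_less_iff_neq_zero)
  show ?thesis
    unfolding positive_compacts_def fin using pos by blast
qed

lemma apply_uniform_mean:
  "blinfun_apply (uniform_mean A) \<phi> = (\<Sum>y\<in>A. apply_bcontfun \<phi> y) / of_nat (card A)"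
proof -
  have "bounded_linear (\<lambda>\<phi> :: 'a linfty. apply_bcontfun \<phi> y)" for y
    by (rule bounded_linear_intro[where K = 1]) (auto intro: norm_bounded)
  then have "bounded_linear (\<lambda>\<phi> :: 'a linfty. (\<Sum>y\<in>A. apply_bcontfun \<phi> y) / of_nat (card A))"
    by (intro bounded_linear_divide[THEN bounded_linear_compose] bounded_linear_sum)
  then show ?thesis
    unfolding uniform_mean_def by (simp add: bounded_linear_Blinfun_apply)
qed

lemma eventually_tails:
  assumes "directed_by I le"
  shows "eventually P (tails I le) \<longleftrightarrow> (\<exists>a\<in>I. \<forall>b\<in>I. le a b \<longrightarrow> P b)"
proof -
  have "\<exists>c\<in>I. {x \<in> I. le c x} \<subseteq> {x \<in> I. le a x} \<inter> {x \<in> I. le b x}" if "a \<in> I" "b \<in> I" for a b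
    using assms that unfolding directed_by_def by (blast dest: transp_onD)
  then show ?thesis
    using assms unfolding tails_def directed_by_def
    by (subst eventually_INF_base) (auto simp: eventually_principal)
qed

end

theory Submission
  imports Defs "HOL-Library.Multiset"
begin

text \<open>
  Weak-* closeness to \<open>\<mu>\<close> only tests finitely many bounded functions up to a tolerance. These
  functions have totally bounded ranges, so the group splits into finitely many cells on each of
  which all of them are almost constant (\<open>exists_fine_labelling\<close>), and a mean is then
  determined, up to the tolerance, by the masses it gives to the cells
  (\<open>means_close_of_cells_close\<close>). It thus suffices to find a finite set \<open>S\<close>, disjoint from
  its translate by \<open>x\<close>, whose proportion of points in each cell is close to the mass of
  that cell under \<open>\<mu>\<close>.

  The masses are nonnegative and add up to \<open>1\<close> (\<open>means_one\<close>), so they are approximated by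
  the frequencies of a finite multiset of cells, and cells of mass zero can be avoided
  altogether (\<open>exists_multiset_frequencies\<close>). Because \<open>\<mu>\<close> vanishes on finite sets, the cells
  that do occur are infinite. The points of \<open>S\<close> can therefore be chosen one at a time: a new
  point must avoid \<open>S\<close>, \<open>x + S\<close> and \<open>-x + S\<close>, which are finitely many points of an infinite
  cell (\<open>exists_translate_free_transversal\<close>). Here \<open>x \<noteq> 0\<close> ensures that a new point does not
  collide with its own translate.

  Choosing such a set for every open neighbourhood of \<open>\<mu>\<close> gives a net indexed by the
  neighbourhoods, ordered by reverse inclusion.
\<close>

section \<open>Bounded functions on a discrete space and their means\<close>

lemma apply_Bcontfun_discrete:
  fixes f :: "'a::discrete_topology \<Rightarrow> 'b::metric_space"
  assumes "bounded (range f)"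
  shows "apply_bcontfun (Bcontfun f) = f"
  using assms
  by (intro Bcontfun_inverse) (auto simp: bcontfun_def continuous_on_open_vimage open_discrete)

lemma bounded_range_bcontfun: "bounded (range (apply_bcontfun f))"
  using apply_bcontfun[of f] by (simp add: bcontfun_def)

lemma apply_bcontfun_sum:
  "apply_bcontfun (\<Sum>j\<in>J. f j) y = (\<Sum>j\<in>J. apply_bcontfun (f j) y)"
  by (induction J rule: infinite_finite_induct) auto

lemma means_homogeneous:
  assumes "\<mu> \<in> means" "\<And>y. apply_bcontfun \<psi> y = c * apply_bcontfun \<phi> y"
  shows "blinfun_apply \<mu> \<psi> = c * blinfun_apply \<mu> \<phi>"
  using assms unfolding means_def by blast

lemma means_nonneg:
  assumes "\<mu> \<in> means" "\<And>y. apply_bcontfun \<phi> y \<in> \<real>\<^sub>\<ge>\<^sub>0"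
  shows "blinfun_apply \<mu> \<phi> \<in> \<real>\<^sub>\<ge>\<^sub>0"
  using assms unfolding means_def by blast

lemma norm_means: "\<mu> \<in> means \<Longrightarrow> norm \<mu> = 1"
  unfolding means_def by blast

lemma norm_means_apply_le:
  assumes "\<mu> \<in> means"
  shows "norm (blinfun_apply \<mu> \<phi>) \<le> norm \<phi>"
  using norm_blinfun[of \<mu> \<phi>] norm_means[OF assms] by simp

text \<open>
  Positivity bounds \<open>\<mu>\<close> on real functions by \<open>c = \<mu>(1)\<close> times their supremum. Rotating a
  complex function \<open>\<phi>\<close> by a unimodular scalar that makes \<open>\<mu>(\<phi>)\<close> nonnegative reduces to
  this case without any loss in the constant, so \<open>1 = \<parallel>\<mu>\<parallel> \<le> c\<close>.
\<close>

lemma means_one: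
  assumes \<mu>: "\<mu> \<in> means"
  shows "blinfun_apply \<mu> (linfty_indicator UNIV) = 1"
proof -
  let ?one = "linfty_indicator (UNIV :: 'a set)"
  define c where "c = Re (blinfun_apply \<mu> ?one)"
  have "blinfun_apply \<mu> ?one \<in> \<real>\<^sub>\<ge>\<^sub>0"
    by (rule means_nonneg[OF \<mu>]) (simp add: apply_linfty_indicator)
  then have c: "blinfun_apply \<mu> ?one = of_real c" "0 \<le> c"
    by (auto simp: c_def complex_nonneg_Reals_iff complex_eq_iff)
  have real_le: "blinfun_apply \<mu> (Bcontfun (\<lambda>y. of_real (u y))) \<in> \<real>
      \<and> Re (blinfun_apply \<mu> (Bcontfun (\<lambda>y. of_real (u y)))) \<le> c * b"
    if u: "\<And>y. \<bar>u y\<bar> \<le> b" for u :: "'a \<Rightarrow> real" and b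
  proof -
    let ?u = "Bcontfun (\<lambda>y. complex_of_real (u y))"
    let ?b = "Bcontfun (\<lambda>y::'a. complex_of_real b)"
    have au: "apply_bcontfun ?u y = of_real (u y)" for y
      using u by (subst apply_Bcontfun_discrete) (auto intro!: boundedI[where B = b])
    have ab: "apply_bcontfun ?b y = of_real b" for y
      by (subst apply_Bcontfun_discrete) auto
    have "blinfun_apply \<mu> (?b - ?u) \<in> \<real>\<^sub>\<ge>\<^sub>0"
    proof (rule means_nonneg[OF \<mu>])
      fix y show "apply_bcontfun (?b - ?u) y \<in> \<real>\<^sub>\<ge>\<^sub>0"
        using u[of y] by (simp add: au ab complex_nonneg_Reals_iff)
    qed
    moreover have "blinfun_apply \<mu> ?b = of_real b * of_real c"
      using means_homogeneous[OF \<mu>, of ?b "of_real b" ?one]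
      by (simp add: ab apply_linfty_indicator c)
    ultimately show ?thesis
      by (auto simp: blinfun.diff_right complex_nonneg_Reals_iff complex_is_Real_iff mult.commute)
  qed
  have "norm (blinfun_apply \<mu> \<phi>) \<le> c * norm \<phi>" for \<phi>
  proof -
    define z where "z = blinfun_apply \<mu> \<phi>"
    \<comment> \<open>The scalar that rotates \<open>z\<close> onto the nonnegative real axis.\<close>
    define a where "a = (if z = 0 then 1 else cnj z / norm z)"
    have na: "norm a = 1"
      by (simp add: a_def norm_divide)
    have az: "a * z = of_real (norm z)"
      using complex_norm_square[of z] by (auto simp: a_def power2_eq_square field_simps)
    define u where "u y = Re (a * apply_bcontfun \<phi> y)" for y
    define v where "v y = Im (a * apply_bcontfun \<phi> y)" for y
    have bd: "norm (a * apply_bcontfun \<phi> y) \<le> norm \<phi>" for y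
      by (simp add: norm_mult na norm_bounded)
    have u: "\<bar>u y\<bar> \<le> norm \<phi>" and v: "\<bar>v y\<bar> \<le> norm \<phi>" for y
      unfolding u_def v_def
      using bd[of y] abs_Re_le_cmod abs_Im_le_cmod order_trans by blast+
    have split: "of_real (u y) + \<i> * of_real (v y) = a * apply_bcontfun \<phi> y" for y
      unfolding u_def v_def by (rule complex_eq[symmetric])
    let ?R = "Bcontfun (\<lambda>y. complex_of_real (u y))"
    let ?I = "Bcontfun (\<lambda>y. complex_of_real (v y))"
    let ?J = "Bcontfun (\<lambda>y. \<i> * complex_of_real (v y))"
    have aR: "apply_bcontfun ?R = (\<lambda>y. of_real (u y))"
      by (rule apply_Bcontfun_discrete, rule boundedI[where B = "norm \<phi>"]) (use u in auto)
    have aI: "apply_bcontfun ?I = (\<lambda>y. of_real (v y))"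
      by (rule apply_Bcontfun_discrete, rule boundedI[where B = "norm \<phi>"]) (use v in auto)
    have aJ: "apply_bcontfun ?J = (\<lambda>y. \<i> * of_real (v y))"
      by (rule apply_Bcontfun_discrete, rule boundedI[where B = "norm \<phi>"])
         (use v in \<open>auto simp: norm_mult\<close>)
    have "blinfun_apply \<mu> (?R + ?J) = a * z"
      unfolding z_def
      by (rule means_homogeneous[OF \<mu>]) (simp only: plus_bcontfun.rep_eq aR aJ split)
    moreover have "blinfun_apply \<mu> ?J = \<i> * blinfun_apply \<mu> ?I"
      by (rule means_homogeneous[OF \<mu>]) (simp only: aI aJ)
    ultimately have "Re (blinfun_apply \<mu> ?R) - Im (blinfun_apply \<mu> ?I) = Re (a * z)"
      by (metis blinfun.add_right plus_complex.sel(1) Re_i_times add_uminus_conv_diff)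
    \<comment> \<open>\<open>\<mu>\<close> is real on real functions, so the imaginary part of \<open>a * \<phi>\<close> drops out.\<close>
    then have "Re (a * z) \<le> c * norm \<phi>"
      using real_le[of u, OF u] real_le[of v, OF v] by (simp add: complex_is_Real_iff)
    then show ?thesis
      unfolding az by (simp only: z_def complex.sel Re_complex_of_real)
  qed
  then have "norm \<mu> \<le> c"
    by (rule norm_blinfun_bound[OF c(2)])
  moreover have "c \<le> 1"
    using norm_means_apply_le[OF \<mu>, of ?one] c
      norm_bound[of ?one 1] by (auto simp: apply_linfty_indicator)
  ultimately show ?thesis
    using norm_means[OF \<mu>] c by simp
qed

lemma uniform_mean_in_means:
  assumes "finite S" "S \<noteq> {}"
  shows "uniform_mean S \<in> means"
proof -
  have c: "0 < card S"
    using assms by (simp add: card_gt_0_iff)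
  have "norm (blinfun_apply (uniform_mean S) \<phi>) \<le> 1 * norm \<phi>" for \<phi>
  proof -
    have "norm (\<Sum>y\<in>S. apply_bcontfun \<phi> y) \<le> of_nat (card S) * norm \<phi>"
      by (rule sum_norm_bound) (simp add: norm_bounded)
    then show ?thesis
      using c by (simp add: apply_uniform_mean norm_divide field_simps)
  qed
  then have "norm (uniform_mean S) \<le> 1"
    by (intro norm_blinfun_bound) auto
  moreover have "1 \<le> norm (uniform_mean S)"
  proof -
    have "norm (linfty_indicator (UNIV :: 'a set)) \<le> 1"
      by (rule norm_bound) (simp add: apply_linfty_indicator)
    moreover have "blinfun_apply (uniform_mean S) (linfty_indicator UNIV) = 1"
      using c by (simp add: apply_uniform_mean apply_linfty_indicator)
    ultimately show ?thesis
      using norm_blinfun[of "uniform_mean S" "linfty_indicator UNIV"]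
      by (smt (verit) mult_left_le norm_ge_zero norm_one)
  qed
  moreover have "blinfun_apply (uniform_mean S) \<phi> \<in> \<real>\<^sub>\<ge>\<^sub>0"
    if "\<forall>y. apply_bcontfun \<phi> y \<in> \<real>\<^sub>\<ge>\<^sub>0" for \<phi>
    using that
    by (auto simp: apply_uniform_mean complex_nonneg_Reals_iff Re_divide_of_nat Im_divide_of_nat sum_nonneg)
  ultimately show ?thesis
    unfolding means_def by (auto simp: apply_uniform_mean sum_distrib_left)
qed

lemma uniform_mean_indicator:
  assumes "finite S"
  shows "blinfun_apply (uniform_mean S) (linfty_indicator E) = of_real (card (S \<inter> E) / card S)"
  using assms
  by (simp add: apply_uniform_mean apply_linfty_indicator indicator_def sum.If_cases Int_def)

section \<open>Means are determined by their values on fine partitions\<close>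

text \<open>
  A finite partition is encoded by a labelling \<open>q\<close>, the cells being the fibres of \<open>q\<close>; simple
  functions are then the functions that factor through \<open>q\<close>.
\<close>

lemma functional_simple:
  fixes \<mu> :: "'a::discrete_topology functional" and q :: "'a \<Rightarrow> 'l"
  assumes \<mu>: "\<mu> \<in> means" and fin: "finite J" and q: "\<And>y. q y \<in> J"
  shows "blinfun_apply \<mu> (Bcontfun (\<lambda>y. g (q y)))
    = (\<Sum>j\<in>J. g j * blinfun_apply \<mu> (linfty_indicator (q -` {j})))"
proof -
  define s where "s j = Bcontfun (\<lambda>y. g j * indicator (q -` {j}) y)" for j
  have s: "apply_bcontfun (s j) y = g j * indicator (q -` {j}) y" for j y
    unfolding s_def
    by (subst apply_Bcontfun_discrete)
       (auto intro!: boundedI[where B = "norm (g j)"] simp: indicator_def)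
  have "finite (range (\<lambda>y. g (q y)))"
    by (rule finite_subset[of _ "g ` J"]) (use fin q in auto)
  then have "apply_bcontfun (Bcontfun (\<lambda>y. g (q y))) = (\<lambda>y. g (q y))"
    by (intro apply_Bcontfun_discrete finite_imp_bounded)
  moreover have "(\<Sum>j\<in>J. g j * indicator (q -` {j}) y) = g (q y)" for y
    using fin q by (simp add: indicator_def if_distrib sum.delta' cong: if_cong)
  ultimately have "Bcontfun (\<lambda>y. g (q y)) = (\<Sum>j\<in>J. s j)"
    by (intro bcontfun_eqI) (simp add: apply_bcontfun_sum s)
  moreover have "blinfun_apply \<mu> (s j) = g j * blinfun_apply \<mu> (linfty_indicator (q -` {j}))" for j
    by (rule means_homogeneous[OF \<mu>]) (simp add: s apply_linfty_indicator)
  ultimately show ?thesis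
    by (simp add: blinfun.sum_right)
qed

text \<open>
  Replacing \<open>\<phi>\<close> by the simple function that takes on each cell the value of \<open>\<phi>\<close> at one of its
  points costs \<open>\<delta>\<close> for each of the two means, as both have norm \<open>1\<close>. On this simple function
  they differ by a combination of the differences of cell masses, with coefficients bounded
  by \<open>\<parallel>\<phi>\<parallel>\<close>.
\<close>

lemma means_close_of_cells_close:
  fixes \<mu> \<nu> :: "'a::discrete_topology functional" and q :: "'a \<Rightarrow> 'l"
  assumes \<mu>: "\<mu> \<in> means" and \<nu>: "\<nu> \<in> means"
    and fin: "finite J" and q: "\<And>y. q y \<in> J"
    and fine: "\<And>y z. q y = q z \<Longrightarrow> dist (apply_bcontfun \<phi> y) (apply_bcontfun \<phi> z) \<le> \<delta>"
    and cells: "(\<Sum>j\<in>J. dist (blinfun_apply \<nu> (linfty_indicator (q -` {j})))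
      (blinfun_apply \<mu> (linfty_indicator (q -` {j})))) \<le> \<eta>"
  shows "dist (blinfun_apply \<nu> \<phi>) (blinfun_apply \<mu> \<phi>) \<le> 2 * \<delta> + \<eta> * norm \<phi>"
proof -
  \<comment> \<open>On an empty cell \<open>inv q j\<close> is an arbitrary point, but \<open>norm (g j) \<le> norm \<phi>\<close> still holds.\<close>
  define g where "g j = apply_bcontfun \<phi> (inv q j)" for j
  define s where "s = Bcontfun (\<lambda>y. g (q y))"
  have "finite (range (\<lambda>y. g (q y)))"
    by (rule finite_subset[of _ "g ` J"]) (use fin q in auto)
  then have s: "apply_bcontfun s = (\<lambda>y. g (q y))"
    unfolding s_def by (intro apply_Bcontfun_discrete finite_imp_bounded)
  have "norm (\<phi> - s) \<le> \<delta>"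
    by (rule norm_bound) (auto simp: s g_def dist_norm[symmetric] f_inv_into_f intro!: fine)
  then have near: "norm (blinfun_apply \<kappa> \<phi> - blinfun_apply \<kappa> s) \<le> \<delta>" if "\<kappa> \<in> means" for \<kappa>
    using norm_means_apply_le[OF that, of "\<phi> - s"] by (simp add: blinfun.diff_right)
  let ?c = "\<lambda>\<kappa> j. blinfun_apply \<kappa> (linfty_indicator (q -` {j}))"
  have "blinfun_apply \<nu> s - blinfun_apply \<mu> s = (\<Sum>j\<in>J. g j * (?c \<nu> j - ?c \<mu> j))"
    unfolding s_def functional_simple[where q = q, OF \<mu> fin q]
      functional_simple[where q = q, OF \<nu> fin q]
    by (simp add: sum_subtractf right_diff_distrib)
  also have "norm \<dots> \<le> (\<Sum>j\<in>J. norm \<phi> * dist (?c \<nu> j) (?c \<mu> j))"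
    by (rule sum_norm_le)
       (auto simp: norm_mult dist_norm g_def norm_bounded intro!: mult_right_mono)
  also have "\<dots> \<le> norm \<phi> * \<eta>"
    unfolding sum_distrib_left[symmetric] by (rule mult_left_mono[OF cells]) simp
  finally show ?thesis
    using near[OF \<mu>] near[OF \<nu>] unfolding dist_norm
    by (smt (verit, ccfv_SIG) norm_triangle_ineq norm_minus_commute mult.commute
        diff_add_cancel add_diff_eq diff_diff_eq2 norm_diff_triangle_le)
qed

text \<open>
  Each range is totally bounded, so every \<open>\<phi>\<close> has a finite net \<open>K \<phi>\<close>. A point is labelled
  by the family, over \<open>\<phi> \<in> \<Phi>\<close>, of a chosen element of \<open>K \<phi>\<close> close to the value of \<open>\<phi>\<close>;
  this realises the common refinement of the partitions for the single functions.
\<close>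

lemma exists_fine_labelling:
  fixes \<Phi> :: "'a::discrete_topology linfty set"
  assumes "finite \<Phi>" and "\<delta> > 0"
  shows "\<exists>(q :: 'a \<Rightarrow> 'a linfty \<Rightarrow> complex) J. finite J \<and> (\<forall>y. q y \<in> J) \<and>
    (\<forall>\<phi>\<in>\<Phi>. \<forall>y z. q y = q z \<longrightarrow> dist (apply_bcontfun \<phi> y) (apply_bcontfun \<phi> z) \<le> \<delta>)"
proof -
  have "\<exists>K. finite K \<and> (\<forall>y. \<exists>k\<in>K. dist (apply_bcontfun \<phi> y) k < \<delta> / 2)" for \<phi> :: "'a linfty"
  proof -
    have "compact (closure (range (apply_bcontfun \<phi>)))"
      using bounded_range_bcontfun by (simp add: compact_closure)
    then obtain K where K: "finite K"
        "closure (range (apply_bcontfun \<phi>)) \<subseteq> (\<Union>k\<in>K. ball k (\<delta> / 2))"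
      using \<open>\<delta> > 0\<close> unfolding compact_eq_totally_bounded
      by (elim conjE allE[where x = "\<delta> / 2"]) auto
    have "\<exists>k\<in>K. dist (apply_bcontfun \<phi> y) k < \<delta> / 2" for y
    proof -
      have "apply_bcontfun \<phi> y \<in> closure (range (apply_bcontfun \<phi>))"
        by (simp add: closure_subset[THEN subsetD])
      then show ?thesis
        using K(2) by (force simp: dist_commute)
    qed
    then show ?thesis
      using K(1) by blast
  qed
  then have "\<forall>\<phi> :: 'a linfty. \<exists>K. finite K \<and> (\<forall>y. \<exists>k\<in>K. dist (apply_bcontfun \<phi> y) k < \<delta> / 2)"
   
    by blast
  from choice[OF this] obtain K where K: "\<And>\<phi> :: 'a linfty. finite (K \<phi>)"
      "\<And>\<phi> y. \<exists>k\<in>K \<phi>. dist (apply_bcontfun \<phi> y) k < \<delta> / 2"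
    by blast
  define k where "k \<phi> y = (SOME k. k \<in> K \<phi> \<and> dist (apply_bcontfun \<phi> y) k < \<delta> / 2)" for \<phi> y
  have k: "k \<phi> y \<in> K \<phi>" "dist (apply_bcontfun \<phi> y) (k \<phi> y) < \<delta> / 2" for \<phi> y
    using K(2)[where \<phi> = \<phi> and y = y] someI_ex[of "\<lambda>k. k \<in> K \<phi> \<and> dist (apply_bcontfun \<phi> y) k < \<delta> / 2"]
    unfolding k_def by blast+
  define q where "q y = restrict (\<lambda>\<phi>. k \<phi> y) \<Phi>" for y
  have "dist (apply_bcontfun \<phi> y) (apply_bcontfun \<phi> z) \<le> \<delta>" if "\<phi> \<in> \<Phi>" "q y = q z" for \<phi> y z
  proof -
    have "k \<phi> y = k \<phi> z"
      using that unfolding q_def by (metis restrict_apply')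
    then show ?thesis
      using k(2)[of \<phi> y] k(2)[of \<phi> z] by (smt (verit) dist_triangle_half_l)
  qed
  moreover have "finite (PiE \<Phi> K)"
    using assms(1) K(1) by (intro finite_PiE)
  moreover have "q y \<in> PiE \<Phi> K" for y
    using k(1) by (auto simp: q_def)
  ultimately show ?thesis
    by blast
qed

section \<open>Translate-free sets with prescribed cell frequencies\<close>

text \<open>
  The multiset contains \<open>j\<close> exactly \<open>\<lceil>N * w j\<rceil>\<close> times. Rounding up keeps the size at least \<open>N\<close>,
  hence positive, and rounding leaves multiplicity \<open>0\<close> where \<open>w j = 0\<close>. The multiplicities
  and the size are off by at most \<open>1\<close> and \<open>card J\<close>, so the total error
  is at most \<open>2 * card J / N\<close>.
\<close>

lemma exists_multiset_frequencies:
  fixes w :: "'l \<Rightarrow> real"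
  assumes fin: "finite J" and w: "\<And>j. j \<in> J \<Longrightarrow> 0 \<le> w j" "sum w J = 1" and "\<eta> > 0"
  shows "\<exists>M. M \<noteq> {#} \<and> set_mset M \<subseteq> {j \<in> J. 0 < w j} \<and>
    (\<Sum>j\<in>J. \<bar>count M j / size M - w j\<bar>) \<le> \<eta>"
proof -
  define m where "m = real (card J)"
  obtain N :: nat where N: "2 * m / \<eta> < N"
    using reals_Archimedean2 by blast
  have "0 \<le> 2 * m / \<eta>"
    using \<open>\<eta> > 0\<close> by (simp add: m_def)
  with N have N0: "0 < N"
    by (metis of_nat_0_less_iff order_le_less_trans)
  define n where "n j = (if j \<in> J then nat \<lceil>N * w j\<rceil> else 0)" for j
  have "finite {j. 0 < n j}"
    by (rule finite_subset[OF _ fin]) (auto simp: n_def)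
  then obtain M where cM: "\<And>j. count M j = n j"
    using count_Abs_multiset by metis
  have n: "N * w j \<le> n j" "n j \<le> N * w j + 1" if "j \<in> J" for j
    using w(1)[OF that] that of_int_ceiling_le_add_one[of "N * w j"] le_of_int_ceiling[of "N * w j"]
    by (auto simp: n_def of_nat_nat)
  have sub: "set_mset M \<subseteq> {j \<in> J. 0 < w j}"
  proof
    fix j assume "j \<in># M"
    then have "0 < n j"
      unfolding count_greater_zero_iff[symmetric] cM .
    then have "j \<in> J" "0 < \<lceil>N * w j\<rceil>"
      unfolding n_def by (cases "j \<in> J"; simp)+
    then show "j \<in> {j \<in> J. 0 < w j}"
      by (simp add: zero_less_mult_iff)
  qed
  have "size M = (\<Sum>j\<in>J. n j)"
    unfolding size_multiset_overloaded_eq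
    by (rule sum.mono_neutral_cong_left[OF fin])
       (use sub in \<open>auto simp: cM not_in_iff\<close>)
  then have sz: "real (size M) = (\<Sum>j\<in>J. real (n j))"
    by simp
  have "real N = (\<Sum>j\<in>J. N * w j)"
    using w(2) by (simp flip: sum_distrib_left)
  also have "\<dots> \<le> size M"
    unfolding sz by (rule sum_mono) (rule n)
  finally have lo: "real N \<le> size M" .
  have "real (size M) \<le> (\<Sum>j\<in>J. N * w j + 1)"
    unfolding sz by (rule sum_mono) (rule n)
  also have "\<dots> = N + m"
    using w(2) by (simp add: sum.distrib m_def flip: sum_distrib_left)
  finally have hi: "size M \<le> N + m" .
  have pos: "0 < real (size M)"
    using lo N0 by linarith
  then have ne: "M \<noteq> {#}"
    by auto
  have "\<bar>count M j / size M - w j\<bar> \<le> (1 + m * w j) / size M" if j: "j \<in> J" for j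
  proof -
    have "N * w j \<le> size M * w j" "size M * w j \<le> N * w j + m * w j"
      using lo hi w(1)[OF j] by (auto simp: mult_right_mono simp flip: distrib_right)
    then have "\<bar>n j - size M * w j\<bar> \<le> 1 + m * w j"
      using n[OF j] w(1)[OF j] m_def by (simp add: abs_le_iff)
    moreover have "count M j / size M - w j = (n j - size M * w j) / size M"
      using ne by (simp add: cM diff_divide_distrib)
    ultimately show ?thesis
      using pos by (simp add: divide_right_mono)
  qed
  then have "(\<Sum>j\<in>J. \<bar>count M j / size M - w j\<bar>) \<le> (\<Sum>j\<in>J. (1 + m * w j) / size M)"
    by (rule sum_mono)
  also have "\<dots> = 2 * m / size M"
    using w(2) by (simp add: sum.distrib m_def flip: sum_divide_distrib sum_distrib_left)
  also have "\<dots> \<le> 2 * m / N"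
    using lo N0 by (intro divide_left_mono) (auto simp: m_def)
  also have "\<dots> \<le> \<eta>"
    using N N0 \<open>\<eta> > 0\<close> by (simp add: field_simps)
  finally show ?thesis
    using sub pos by (intro exI[of _ M]) auto
qed

text \<open>
  Greedy choice along the multiset: finitely many points chosen so far exclude only finitely
  many candidates from an infinite fibre.
\<close>

lemma exists_translate_free_transversal:
  fixes x :: "'a::group_add" and q :: "'a \<Rightarrow> 'l"
  assumes "x \<noteq> 0" and "\<And>j. j \<in># M \<Longrightarrow> infinite (q -` {j})"
  shows "\<exists>S. finite S \<and> S \<inter> (+) x ` S = {} \<and> image_mset q (mset_set S) = M"
  using assms(2)
proof (induction M)
  case empty
  show ?case
    by (rule exI[of _ "{}"]) simp
next
  case (add j M)
  then obtain S where S: "finite S" "S \<inter> (+) x ` S = {}" "image_mset q (mset_set S) = M"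
    by auto
  have "infinite (q -` {j} - (S \<union> (+) x ` S \<union> (+) (- x) ` S))"
    using add.prems[of j] S(1) by (intro Diff_infinite_finite) auto
  then obtain y where "y \<in> q -` {j} - (S \<union> (+) x ` S \<union> (+) (- x) ` S)"
    by (metis ex_in_conv finite.emptyI)
  then have y: "q y = j" "y \<notin> S" "y \<notin> (+) x ` S" "y \<notin> (+) (- x) ` S"
    by auto
  have "x + y \<notin> S"
    using y(4) by (metis image_eqI minus_add_cancel)
  then have "insert y S \<inter> (+) x ` insert y S = {}"
    using S(2) y(2,3) \<open>x \<noteq> 0\<close> add_right_cancel[of x y 0] by auto
  then show ?case
    using S y by (intro exI[of _ "insert y S"]) auto
qed

text \<open>
  The tolerance is split into \<open>\<epsilon> / 4\<close> for replacing each \<open>\<phi>\<close> by a simple function, incurred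
  once for each of the two means, and \<open>\<epsilon> / 4\<close> for the error in the cell masses.
\<close>

lemma exists_translate_free_approximation:
  fixes \<mu> :: "'a::{group_add, discrete_topology} functional"
  assumes \<mu>: "\<mu> \<in> means"
    and van: "\<And>F :: 'a set. finite F \<Longrightarrow> blinfun_apply \<mu> (linfty_indicator F) = 0"
    and "x \<noteq> 0" and "finite \<Phi>" and "\<epsilon> > 0"
  shows "\<exists>S. finite S \<and> S \<noteq> {} \<and> S \<inter> (+) x ` S = {} \<and>
    (\<forall>\<phi>\<in>\<Phi>. dist (blinfun_apply (uniform_mean S) \<phi>) (blinfun_apply \<mu> \<phi>) < \<epsilon>)"
proof -
  have "0 < \<epsilon> / 4"
    using \<open>\<epsilon> > 0\<close> by simp
  from exists_fine_labelling[OF \<open>finite \<Phi>\<close> this]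
  obtain q :: "'a \<Rightarrow> 'a linfty \<Rightarrow> complex" and J
    where fin: "finite J" and "\<forall>y. q y \<in> J"
      and "\<forall>\<phi>\<in>\<Phi>. \<forall>y z. q y = q z \<longrightarrow>
        dist (apply_bcontfun \<phi> y) (apply_bcontfun \<phi> z) \<le> \<epsilon> / 4"
    by (elim exE conjE)
  then have q: "\<And>y. q y \<in> J"
    and fine: "\<And>\<phi> y z. \<phi> \<in> \<Phi> \<Longrightarrow> q y = q z \<Longrightarrow>
      dist (apply_bcontfun \<phi> y) (apply_bcontfun \<phi> z) \<le> \<epsilon> / 4"
    by simp_all
  define B where "B = (\<Sum>\<phi>\<in>\<Phi>. norm \<phi>)"
  have "0 \<le> B"
    unfolding B_def by (rule sum_nonneg) simp
  \<comment> \<open>Adding \<open>1\<close> keeps the denominator positive when every \<open>\<phi>\<close> is zero.\<close>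
  define \<eta> where "\<eta> = \<epsilon> / (4 * (B + 1))"
  have "\<eta> > 0"
    using \<open>\<epsilon> > 0\<close> \<open>0 \<le> B\<close> by (simp add: \<eta>_def)
  define w where "w j = Re (blinfun_apply \<mu> (linfty_indicator (q -` {j})))" for j
  have "blinfun_apply \<mu> (linfty_indicator (q -` {j})) \<in> \<real>\<^sub>\<ge>\<^sub>0" for j
    by (rule means_nonneg[OF \<mu>]) (simp add: apply_linfty_indicator indicator_def)
  then have w: "blinfun_apply \<mu> (linfty_indicator (q -` {j})) = of_real (w j)" "0 \<le> w j" for j
    by (auto simp: w_def complex_nonneg_Reals_iff complex_eq_iff)
  have "linfty_indicator UNIV = Bcontfun (\<lambda>y. (\<lambda>_. 1) (q y))"
    by (simp add: linfty_indicator_def indicator_def)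
  then have "(\<Sum>j\<in>J. complex_of_real (w j)) = 1"
    using functional_simple[where q = q and g = "\<lambda>_. 1", OF \<mu> fin q] means_one[OF \<mu>] by (simp add: w)
  then have "sum w J = 1"
    by (metis of_real_sum of_real_eq_1_iff)
  from exists_multiset_frequencies[OF fin w(2) this \<open>\<eta> > 0\<close>]
  obtain M where M: "M \<noteq> {#}" "set_mset M \<subseteq> {j \<in> J. 0 < w j}"
      "(\<Sum>j\<in>J. \<bar>count M j / size M - w j\<bar>) \<le> \<eta>"
    by blast
  have "infinite (q -` {j})" if "j \<in># M" for j
    using M(2) that van[of "q -` {j}"] w(1)[of j] by auto
  from exists_translate_free_transversal[OF \<open>x \<noteq> 0\<close> this]
  obtain S where S: "finite S" "S \<inter> (+) x ` S = {}" "image_mset q (mset_set S) = M"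
    by blast
  have "S \<noteq> {}"
    using S(3) M(1) by auto
  have sz: "card S = size M" and ct: "card (S \<inter> q -` {j}) = count M j" for j
    using S(1) by (auto simp flip: S(3) simp: count_image_mset' Int_def vimage_def
        sum.If_cases count_mset_set' intro!: arg_cong[where f = card])
  have cells: "(\<Sum>j\<in>J. dist (blinfun_apply (uniform_mean S) (linfty_indicator (q -` {j})))
      (blinfun_apply \<mu> (linfty_indicator (q -` {j})))) \<le> \<eta>"
    using M(3) by (simp only: uniform_mean_indicator[OF S(1)] w sz ct dist_of_real dist_real_def)
  have "dist (blinfun_apply (uniform_mean S) \<phi>) (blinfun_apply \<mu> \<phi>) < \<epsilon>" if "\<phi> \<in> \<Phi>" for \<phi>
  proof -
    have "dist (blinfun_apply (uniform_mean S) \<phi>) (blinfun_apply \<mu> \<phi>) \<le> 2 * (\<epsilon> / 4) + \<eta> * norm \<phi>"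
      by (rule means_close_of_cells_close[where q = q,
            OF \<mu> uniform_mean_in_means[OF S(1) \<open>S \<noteq> {}\<close>] fin q fine[OF that] cells])
    also have "norm \<phi> \<le> B"
      unfolding B_def using that \<open>finite \<Phi>\<close> by (intro member_le_sum) auto
    then have "\<eta> * norm \<phi> \<le> \<eta> * (B + 1)"
      using \<open>\<eta> > 0\<close> by simp
    also have "\<eta> * (B + 1) = \<epsilon> / 4"
      using \<open>0 \<le> B\<close> unfolding \<eta>_def by (simp add: divide_simps)
    finally show ?thesis
      using \<open>\<epsilon> > 0\<close> by simp
  qed
  then show ?thesis
    using S \<open>S \<noteq> {}\<close> by blast
qed

section \<open>The net\<close>

text \<open>
  A basic open set of the product topology restricts only finitely many coordinates, so one
  radius serves for all of them.
\<close>

lemma strong_operator_topology_neighbourhood: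
  fixes \<mu> :: "'b::real_normed_vector \<Rightarrow>\<^sub>L 'c::real_normed_vector"
  assumes "openin strong_operator_topology T" and "\<mu> \<in> T"
  shows "\<exists>\<Phi> \<epsilon>. finite \<Phi> \<and> 0 < \<epsilon> \<and>
    (\<forall>\<nu>. (\<forall>\<phi>\<in>\<Phi>. dist (blinfun_apply \<nu> \<phi>) (blinfun_apply \<mu> \<phi>) < \<epsilon>) \<longrightarrow> \<nu> \<in> T)"
proof -
  obtain V where V: "open V" "T = blinfun_apply -` V"
    using assms(1) unfolding strong_operator_topology_def openin_pullback_topology by auto
  then have "openin (product_topology (\<lambda>_. euclidean) UNIV) V" "blinfun_apply \<mu> \<in> V"
    using assms(2) by (auto simp: open_fun_def)
  then obtain X where X: "blinfun_apply \<mu> \<in> PiE UNIV X" "\<And>\<phi>. open (X \<phi>)"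
      "finite {\<phi>. X \<phi> \<noteq> UNIV}" "PiE UNIV X \<subseteq> V"
    using product_topology_open_contains_basis[of "\<lambda>_. euclidean" UNIV V "blinfun_apply \<mu>"]
    by auto
  define \<Phi> where "\<Phi> = {\<phi>. X \<phi> \<noteq> UNIV}"
  have "\<forall>\<phi>. \<exists>e>0. ball (blinfun_apply \<mu> \<phi>) e \<subseteq> X \<phi>"
    using X(1,2) by (auto simp: PiE_UNIV_domain open_contains_ball)
  then obtain e where e: "\<And>\<phi>. 0 < e \<phi>" "\<And>\<phi>. ball (blinfun_apply \<mu> \<phi>) (e \<phi>) \<subseteq> X \<phi>"
    by metis
  \<comment> \<open>Including \<open>1\<close> keeps the minimum meaningful when no coordinate is restricted.\<close>
  define \<epsilon> where "\<epsilon> = Min (insert 1 (e ` \<Phi>))"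
  have fin: "finite \<Phi>"
    using X(3) by (simp add: \<Phi>_def)
  then have "0 < \<epsilon>" and le: "\<And>\<phi>. \<phi> \<in> \<Phi> \<Longrightarrow> \<epsilon> \<le> e \<phi>"
    using e(1) by (auto simp: \<epsilon>_def)
  have "\<nu> \<in> T" if \<nu>: "\<forall>\<phi>\<in>\<Phi>. dist (blinfun_apply \<nu> \<phi>) (blinfun_apply \<mu> \<phi>) < \<epsilon>" for \<nu>
  proof -
    have "blinfun_apply \<nu> \<phi> \<in> X \<phi>" for \<phi>
    proof (cases "\<phi> \<in> \<Phi>")
      case True
      then have "dist (blinfun_apply \<mu> \<phi>) (blinfun_apply \<nu> \<phi>) < e \<phi>"
        using \<nu> le[OF True] by (metis dist_commute less_le_trans)
      then show ?thesis
        using e(2)[of \<phi>] unfolding ball_def by blast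
    qed (simp add: \<Phi>_def)
    then show ?thesis
      using X(4) unfolding V(2) PiE_UNIV_domain by blast
  qed
  then show ?thesis
    using fin \<open>0 < \<epsilon>\<close> by blast
qed

theorem mainTheorem8:
  fixes \<mu> :: "'a::{group_add, discrete_topology} functional" and x :: 'a
  assumes "\<mu> \<in> means"
    and "\<And>F :: 'a set. finite F \<Longrightarrow> blinfun_apply \<mu> (linfty_indicator F) = 0"
    and "x \<noteq> 0"
  shows "\<exists>(I :: 'a functional set set) le (S :: 'a functional set \<Rightarrow> 'a set).
    directed_by I le \<and>
    (\<forall>\<alpha>\<in>I. S \<alpha> \<in> positive_compacts) \<and>
    limitin means_topology (\<lambda>\<alpha>. uniform_mean (S \<alpha>)) \<mu> (tails I le) \<and>
    (\<forall>\<alpha>\<in>I. S \<alpha> \<inter> (+) x ` S \<alpha> = {})"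
proof -
  define I where "I = {U. openin means_topology U \<and> \<mu> \<in> U}"
  define le :: "'a functional set \<Rightarrow> 'a functional set \<Rightarrow> bool" where "le U V \<longleftrightarrow> V \<subseteq> U" for U V
  have top: "\<mu> \<in> topspace means_topology"
    using assms(1) by (simp add: means_topology_def strong_operator_topology_topspace)
  have dir: "directed_by I le"
    unfolding directed_by_def
  proof (intro conjI ballI)
    show "I \<noteq> {}"
      using top by (auto simp: I_def)
    show "reflp_on I le" "transp_on I le"
      by (auto simp: le_def reflp_on_def transp_on_def)
    fix U V assume "U \<in> I" "V \<in> I"
    then show "\<exists>W\<in>I. le U W \<and> le V W"
      by (intro bexI[of _ "U \<inter> V"]) (auto simp: I_def le_def)
  qed
  have "\<exists>S. S \<in> positive_compacts \<and> S \<inter> (+) x ` S = {} \<and> uniform_mean S \<in> U" if "U \<in> I" for U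
  proof -
    obtain T where T: "openin strong_operator_topology T" "U = T \<inter> means"
      using \<open>U \<in> I\<close> unfolding I_def means_topology_def openin_subtopology by blast
    then obtain \<Phi> \<epsilon> where "finite \<Phi>" "0 < \<epsilon>" and sub:
      "\<And>\<nu>. (\<forall>\<phi>\<in>\<Phi>. dist (blinfun_apply \<nu> \<phi>) (blinfun_apply \<mu> \<phi>) < \<epsilon>) \<Longrightarrow> \<nu> \<in> T"
      using strong_operator_topology_neighbourhood[of T \<mu>] \<open>U \<in> I\<close> by (auto simp: I_def)
    from exists_translate_free_approximation[OF assms this(1,2)]
    obtain S where "finite S" "S \<noteq> {}" "S \<inter> (+) x ` S = {}"
      "\<forall>\<phi>\<in>\<Phi>. dist (blinfun_apply (uniform_mean S) \<phi>) (blinfun_apply \<mu> \<phi>) < \<epsilon>"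
      by blast
    then show ?thesis
      using sub uniform_mean_in_means[of S] T(2) by (auto simp: positive_compacts_eq)
  qed
  then obtain S where S: "\<And>U. U \<in> I \<Longrightarrow> S U \<in> positive_compacts"
    "\<And>U. U \<in> I \<Longrightarrow> S U \<inter> (+) x ` S U = {}" "\<And>U. U \<in> I \<Longrightarrow> uniform_mean (S U) \<in> U"
    by metis
  have "limitin means_topology (\<lambda>U. uniform_mean (S U)) \<mu> (tails I le)"
    unfolding limitin_def eventually_tails[OF dir]
    using top S(3) by (auto simp: I_def le_def)
  then show ?thesis
    using dir S(1,2) by blast
qed

end
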